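(* For each positive integer $T\ge 9$ divisible by $6$, consider the instance with horizon $T$, capacity $B=T/6$ and $k=3$ customer types with $$\lambda_1=\tfrac16,\ v_1=\tfrac12,\ p_1=1;\qquad \lambda_2=\tfrac13,\ v_2=\tfrac1{\sqrt T},\ p_2=\tfrac3{\sqrt T};\qquad \lambda_3=\tfrac12,\ v_3=0,\ p_3=1.$$ Then any online policy, even with full knowledge of the first $T/2$ arrivals, incurs an expected loss of $\Omega(\sqrt T)$ relative to the clairvoyant: there exist constants $c>0$ and $T_0$ such that for all such $T\ge T_0$ and every online policy that may additionally base its decisions on $A_1,\dots,A_{T/2}$ from the start, $$\mathbb E\left[\widehat{\mathrm{OPT}}_{\vec A}-\mathrm{POL}_{\vec A}\right]\ge c\sqrt T,$$ where $\mathrm{POL}_{\vec A}$ is the objective obtained by the policy.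
   Context: $\mathbb N=\{0,1,2,\dots\}$. In each period $t=1,\dots,T$ one customer arrives; the types $A_1,\dots,A_T$ are i.i.d. with $\mathbb P[A_t=j]=\lambda_j$, and $\vec A=(A_1,\dots,A_T)$. On arrival each customer is irrevocably accepted or rejected. An online policy's decision in period $t$ depends only on $A_1,\dots,A_t$ (and possibly independent randomization), not on future arrivals; a policy with full knowledge of the first $T/2$ arrivals may have its decision in period $t$ depend on $A_1,\dots,A_{\max(t,T/2)}$. If $\vec x\in\mathbb N^k$ customers (by type) are accepted in total, the objective is $\sum_jv_jx_j-\mathbb E\big[\big(\sum_jX_{j,x_j}-B\big)^+\big]$, where $X_{j,x_j}\sim\mathrm{Bin}(x_j,p_j)$ are independent. $\widehat{\mathrm{OPT}}_{\vec A}$ is the maximum of this objective over $\vec x\in\mathbb N^k$ with $0\le x_j\le N_j$, where $N_j$ is the number of type $j$ arrivals in $\vec A$. *)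

theory Defs
  imports "HOL-Probability.Probability"
begin

record overbooking =
  horizon :: nat
  capacity :: real
  num_types :: nat
  arrival_prob :: "nat \<Rightarrow> real"
  fare :: "nat \<Rightarrow> real"
  show_prob :: "nat \<Rightarrow> real"

definition customer_types :: "overbooking \<Rightarrow> nat set" where
  "customer_types I = {1..num_types I}"

definition type_pmf :: "overbooking \<Rightarrow> nat pmf" where
  "type_pmf I = embed_pmf (\<lambda>j. if j \<in> customer_types I then arrival_prob I j else 0)"

lemma pmf_type_pmf:
  assumes "\<And>j. j \<in> customer_types I \<Longrightarrow> arrival_prob I j \<ge> 0"
    and "(\<Sum>j\<in>customer_types I. arrival_prob I j) = 1"
  shows "pmf (type_pmf I) j = (if j \<in> customer_types I then arrival_prob I j else 0)"
  unfolding type_pmf_def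
proof (rule pmf_embed_pmf)
  let ?f = "\<lambda>j. if j \<in> customer_types I then arrival_prob I j else 0"
  have fin: "finite (customer_types I)"
    by (simp add: customer_types_def)
  have "(\<integral>\<^sup>+j. ennreal (?f j) \<partial>count_space UNIV)
      = (\<integral>\<^sup>+j. ennreal (arrival_prob I j) \<partial>count_space (customer_types I))"
    by (subst nn_integral_count_space_indicator)
       (auto intro!: nn_integral_cong simp: indicator_def)
  also have "\<dots> = (\<Sum>j\<in>customer_types I. ennreal (arrival_prob I j))"
    using fin by (rule nn_integral_count_space_finite)
  also have "\<dots> = 1"
    using assms by (simp add: sum_ennreal)
  finally show "(\<integral>\<^sup>+j. ennreal (?f j) \<partial>count_space UNIV) = 1" .
qed (use assms in auto)

text \<open>Periods are numbered from 1 to the horizon; an arrival sequence is 0 in all other periods.\<close>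

definition arrivals_pmf :: "overbooking \<Rightarrow> (nat \<Rightarrow> nat) pmf" where
  "arrivals_pmf I = Pi_pmf {1..horizon I} 0 (\<lambda>_. type_pmf I)"

definition shows_pmf :: "overbooking \<Rightarrow> (nat \<Rightarrow> nat) \<Rightarrow> (nat \<Rightarrow> nat) pmf" where
  "shows_pmf I x = Pi_pmf (customer_types I) 0 (\<lambda>j. binomial_pmf (x j) (show_prob I j))"

definition objective :: "overbooking \<Rightarrow> (nat \<Rightarrow> nat) \<Rightarrow> real" where
  "objective I x =
     (\<Sum>j\<in>customer_types I. fare I j * real (x j))
     - measure_pmf.expectation (shows_pmf I x)
         (\<lambda>X. max 0 ((\<Sum>j\<in>customer_types I. real (X j)) - capacity I))"

definition num_arrivals :: "overbooking \<Rightarrow> (nat \<Rightarrow> nat) \<Rightarrow> nat \<Rightarrow> nat" where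
  "num_arrivals I A j = card {t \<in> {1..horizon I}. A t = j}"

text \<open>Acceptance vectors are extensional functions on the customer types, so that the maximum
  ranges over a finite nonempty set.\<close>

definition offline_opt :: "overbooking \<Rightarrow> (nat \<Rightarrow> nat) \<Rightarrow> real" where
  "offline_opt I A =
     Max (objective I ` (\<Pi>\<^sub>E j\<in>customer_types I. {0..num_arrivals I A j}))"

text \<open>A policy maps a random seed, a period and the arrival sequence to the decision whether the
  customer arriving in that period is accepted. The seed is drawn from an arbitrary probability
  space on the reals, independently of the arrivals. The decision in period \<open>t\<close> may depend only on
  the seed and on the arrivals in periods \<open>1, \<dots>, max t h\<close>: the first \<open>h\<close> arrivals are known
  from the start, and \<open>h = 0\<close> gives the ordinary online policies. Past decisions are themselves
  functions of this information.\<close>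

type_synonym policy = "real \<Rightarrow> nat \<Rightarrow> (nat \<Rightarrow> nat) \<Rightarrow> bool"

definition informed_online_policy ::
    "overbooking \<Rightarrow> nat \<Rightarrow> real measure \<Rightarrow> policy \<Rightarrow> bool" where
  "informed_online_policy I h R D \<longleftrightarrow>
     prob_space R \<and>
     (\<forall>t\<in>{1..horizon I}. \<forall>A. Measurable.pred R (\<lambda>u. D u t A)) \<and>
     (\<forall>t\<in>{1..horizon I}. \<forall>u\<in>space R. \<forall>A A'.
        (\<forall>s\<in>{1..max t h}. A s = A' s) \<longrightarrow> D u t A = D u t A')"

definition accepted :: "overbooking \<Rightarrow> policy \<Rightarrow> real \<Rightarrow> (nat \<Rightarrow> nat) \<Rightarrow> nat \<Rightarrow> nat" where
  "accepted I D u A j = card {t \<in> {1..horizon I}. A t = j \<and> D u t A}"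

definition policy_objective :: "overbooking \<Rightarrow> policy \<Rightarrow> real \<Rightarrow> (nat \<Rightarrow> nat) \<Rightarrow> real" where
  "policy_objective I D u A = objective I (accepted I D u A)"

definition expected_loss :: "overbooking \<Rightarrow> real measure \<Rightarrow> policy \<Rightarrow> real" where
  "expected_loss I R D =
     (\<integral>(A, u). offline_opt I A - policy_objective I D u A
        \<partial>(measure_pmf (arrivals_pmf I) \<Otimes>\<^sub>M R))"

definition hard_instance :: "nat \<Rightarrow> overbooking" where
  "hard_instance T =
     \<lparr> horizon = T,
       capacity = real T / 6,
       num_types = 3,
       arrival_prob = (\<lambda>_. 0)(1 := 1/6, 2 := 1/3, 3 := 1/2),
       fare = (\<lambda>_. 0)(1 := 1/2, 2 := 1 / sqrt (real T), 3 := 0),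
       show_prob = (\<lambda>_. 0)(1 := 1, 2 := 3 / sqrt (real T), 3 := 1) \<rparr>"

lemma pmf_type_pmf_hard_instance:
  "pmf (type_pmf (hard_instance T)) 1 = 1/6"
  "pmf (type_pmf (hard_instance T)) 2 = 1/3"
  "pmf (type_pmf (hard_instance T)) 3 = 1/2"
proof -
  have types: "customer_types (hard_instance T) = {1, 2, 3}"
    by (auto simp: customer_types_def hard_instance_def)
  have *: "pmf (type_pmf (hard_instance T)) j =
      (if j \<in> {1, 2, 3} then arrival_prob (hard_instance T) j else 0)" for j
    unfolding types[symmetric]
    by (rule pmf_type_pmf) (auto simp: types, auto simp: hard_instance_def)
  show "pmf (type_pmf (hard_instance T)) 1 = 1/6"
    "pmf (type_pmf (hard_instance T)) 2 = 1/3"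
    "pmf (type_pmf (hard_instance T)) 3 = 1/2"
    unfolding * by (simp_all add: hard_instance_def)
qed

end

theory Submission
  imports Defs
begin

text \<open>
  Type 1 arrivals fluctuate around the capacity on the scale \<open>sqrt T\<close>, and the expected number of
  type 2 customers showing up is of the same order. If the type 1 arrivals reach the capacity, every
  accepted type 2 customer loses at least \<open>1 / (2 * sqrt T)\<close>; if they fall short of it by
  \<open>4 * sqrt T\<close>, every rejected type 2 customer loses \<open>1 / sqrt T\<close>, up to an additive constant for the
  overflow. With probability at least 1/2 the first half brings at least \<open>T / 12\<close> customers of type 2
  and a typical number of type 1. The number of type 2 customers accepted among them is then determined
  by the first half. Given the first half, both extreme scenarios still occur with probability bounded
  below, so one of the two losses, each of order \<open>sqrt T\<close>, is incurred with constant probability.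
\<close>

subsection \<open>Binomial tails\<close>

lemma expectation_binomial_pmf:
  assumes "p \<in> {0..1}"
  shows "measure_pmf.expectation (binomial_pmf n p) real = real n * p"
proof -
  have "measure_pmf.expectation (binomial_pmf n p) real = (\<Sum>k\<le>n. real k * Bernstein n k p)"
    using assms by (simp add: expectation_binomial_pmf' Bernstein_def mult_ac)
  then show ?thesis by simp
qed

text \<open>The square is expanded in \<open>k * (k - 1)\<close>, \<open>k\<close> and 1, whose sums
  against the Bernstein polynomials are known.\<close>

lemma variance_binomial_pmf:
  assumes "p \<in> {0..1}"
  shows "measure_pmf.expectation (binomial_pmf n p) (\<lambda>k. (real k - real n * p)\<^sup>2)
    = real n * p * (1 - p)"
proof -
  have "measure_pmf.expectation (binomial_pmf n p) (\<lambda>k. (real k - real n * p)\<^sup>2)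
      = (\<Sum>k\<le>n. (real k - real n * p)\<^sup>2 * Bernstein n k p)"
    using assms by (simp add: expectation_binomial_pmf' Bernstein_def mult_ac)
  also have "\<dots> = (\<Sum>k\<le>n. real k * (real k - 1) * Bernstein n k p)
      + (1 - 2 * real n * p) * (\<Sum>k\<le>n. real k * Bernstein n k p)
      + (real n * p)\<^sup>2 * (\<Sum>k\<le>n. Bernstein n k p)"
    unfolding sum_distrib_left sum.distrib[symmetric]
    by (intro sum.cong) (auto simp: algebra_simps power2_eq_square)
  also have "\<dots> = real n * p * (1 - p)"
    unfolding sum_kk_Bernstein sum_k_Bernstein sum_Bernstein
    by (simp add: algebra_simps power2_eq_square)
  finally show ?thesis .
qed

lemma binomial_pmf_deviation:
  assumes p: "p \<in> {0..1}" and "a > 0"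
  shows "measure_pmf.prob (binomial_pmf n p) {k. \<bar>real k - real n * p\<bar> \<ge> a}
    \<le> real n * p * (1 - p) / a\<^sup>2"
  using measure_pmf.Chebyshev_inequality[of real "binomial_pmf n p" a] assms
  by (simp add: expectation_binomial_pmf variance_binomial_pmf)

text \<open>Change of measure: the log-likelihood ratio of \<open>p'\<close> to \<open>p\<close> is
  linear in \<open>k\<close>, and \<open>ln (1 + x) \<le> x\<close> bounds both of its coefficients
  from above, which is the direction needed for a lower bound under \<open>p\<close>.\<close>

lemma pmf_binomial_tilt:
  assumes p: "0 < p" "p < 1" and p': "0 < p'" "p' < 1" and "k \<le> n"
  shows "exp (- (p' - p) * (real k - real n * p) / (p * (1 - p))) * pmf (binomial_pmf n p') k
    \<le> pmf (binomial_pmf n p) k"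
proof -
  have ln: "ln p' - ln p \<le> (p' - p) / p" "ln (1 - p') - ln (1 - p) \<le> (p - p') / (1 - p)"
    using ln_add_one_self_le_self2[of "(p' - p) / p"]
      ln_add_one_self_le_self2[of "(p - p') / (1 - p)"] p p'
    by (simp_all add: field_simps ln_div)
  have eq: "(p' - p) * (real k - real n * p) / (p * (1 - p))
      = real k * ((p' - p) / p) + real (n - k) * ((p - p') / (1 - p))"
    using p \<open>k \<le> n\<close> by (simp add: field_simps of_nat_diff)
  have pow: "x ^ i = exp (real i * ln x)" if "0 < x" for x :: real and i
    using that by (metis exp_of_nat_mult exp_ln)
  have "real k * (ln p' - ln p) + real (n - k) * (ln (1 - p') - ln (1 - p))
      \<le> (p' - p) * (real k - real n * p) / (p * (1 - p))"
    unfolding eq by (intro add_mono mult_left_mono ln) auto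
  then have "- (p' - p) * (real k - real n * p) / (p * (1 - p))
        + (real k * ln p' + real (n - k) * ln (1 - p')) \<le> real k * ln p + real (n - k) * ln (1 - p)"
    unfolding minus_mult_left[symmetric] minus_divide_left[symmetric] right_diff_distrib[of "real _" "ln _"]
    by linarith
  then have "exp (- (p' - p) * (real k - real n * p) / (p * (1 - p)))
        * (p' ^ k * (1 - p') ^ (n - k)) \<le> p ^ k * (1 - p) ^ (n - k)"
    using p p' by (simp add: pow exp_add[symmetric])
  then have "real (n choose k) * (exp (- (p' - p) * (real k - real n * p) / (p * (1 - p)))
        * (p' ^ k * (1 - p') ^ (n - k))) \<le> real (n choose k) * (p ^ k * (1 - p) ^ (n - k))"
    by (rule mult_left_mono) simp
  then show ?thesis using p p' by (simp add: mult_ac)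
qed

text \<open>Under the tilted parameter \<open>p + a / sqrt n\<close> the window is typical by Chebyshev's inequality,
  and on the window the likelihood ratio is bounded below.\<close>

lemma binomial_pmf_window:
  assumes p: "0 < p" "p < 1" and n: "n > 0"
    and p': "0 < p + a / sqrt n" "p + a / sqrt n < 1"
  shows "3 / 4 * exp (- \<bar>a\<bar> * (\<bar>a\<bar> + 1) / (p * (1 - p)))
    \<le> measure_pmf.prob (binomial_pmf n p) {k. \<bar>real k - real n * p - a * sqrt n\<bar> \<le> sqrt n}"
proof -
  define p' where "p' = p + a / sqrt n"
  \<comment> \<open>Restricting to \<open>k \<le> n\<close> costs no probability, makes
    \<open>W\<close> finite so that point masses can be summed, and meets the hypothesis of
    \<open>pmf_binomial_tilt\<close>.\<close>
  define W where "W = {k. k \<le> n \<and> \<bar>real k - real n * p - a * sqrt n\<bar> \<le> sqrt n}"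
  define e where "e = exp (- \<bar>a\<bar> * (\<bar>a\<bar> + 1) / (p * (1 - p)))"
  have s: "sqrt n * sqrt n = n" "sqrt n > 0" using n by auto
  have mean: "real n * p' = real n * p + a * sqrt n"
    using s by (simp add: p'_def field_simps)
  have p'01: "0 < p'" "p' < 1" using p' by (simp_all add: p'_def)
  have fin: "finite W" by (simp add: W_def)
  have quarter: "p' * (1 - p') \<le> 1 / 4"
    using sum_squares_ge_zero[of "p' - 1/2" 0] by (simp add: algebra_simps power2_eq_square)
  have "measure_pmf.prob (binomial_pmf n p') {k. \<bar>real k - real n * p'\<bar> \<ge> sqrt n}
      \<le> real n * p' * (1 - p') / (sqrt n)\<^sup>2"
    using p'01 s by (intro binomial_pmf_deviation) auto
  also have "\<dots> = p' * (1 - p')" using n by simp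
  finally have dev: "measure_pmf.prob (binomial_pmf n p') {k. \<bar>real k - real n * p'\<bar> \<ge> sqrt n} \<le> 1/4"
    using quarter by linarith
  have "1 - measure_pmf.prob (binomial_pmf n p') {k. \<bar>real k - real n * p'\<bar> \<ge> sqrt n}
      = measure_pmf.prob (binomial_pmf n p') {k. \<not> \<bar>real k - real n * p'\<bar> \<ge> sqrt n}"
    by (subst measure_pmf.prob_compl[symmetric]) (auto intro: arg_cong[where f = "measure _"])
  also have "\<dots> \<le> measure_pmf.prob (binomial_pmf n p') W"
    using p'01 by (intro measure_pmf.finite_measure_mono_AE)
      (auto simp: AE_measure_pmf_iff W_def mean diff_diff_eq)
  finally have W: "3 / 4 \<le> measure_pmf.prob (binomial_pmf n p') W" using dev by linarith
  have tilt: "e * pmf (binomial_pmf n p') k \<le> pmf (binomial_pmf n p) k" if "k \<in> W" for k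
  proof -
    have "\<bar>real k - real n * p\<bar> \<le> (\<bar>a\<bar> + 1) * sqrt n"
    proof -
      have "\<bar>real k - real n * p\<bar> \<le> sqrt n + \<bar>a * sqrt n\<bar>"
        using that unfolding W_def by auto
      then show ?thesis by (simp add: abs_mult algebra_simps)
    qed
    \<comment> \<open>The shift of the parameter has size \<open>\<bar>a\<bar> / sqrt n\<close> and
      the window has width of order \<open>sqrt n\<close>, so \<open>n\<close> cancels in the
      exponent.\<close>
    then have "\<bar>a\<bar> / sqrt n * \<bar>real k - real n * p\<bar> \<le> \<bar>a\<bar> / sqrt n * ((\<bar>a\<bar> + 1) * sqrt n)"
      by (rule mult_left_mono) simp
    also have "\<dots> = \<bar>a\<bar> * (\<bar>a\<bar> + 1)" using s by (simp add: field_simps)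
    also have "\<bar>a\<bar> / sqrt n = \<bar>p' - p\<bar>" by (simp add: p'_def)
    finally have "(p' - p) * (real k - real n * p) \<le> \<bar>a\<bar> * (\<bar>a\<bar> + 1)"
      unfolding abs_mult[symmetric] by (rule order_trans[OF abs_ge_self])
    then have "e \<le> exp (- (p' - p) * (real k - real n * p) / (p * (1 - p)))"
      unfolding e_def exp_le_cancel_iff minus_mult_left[symmetric] using p
      by (intro divide_right_mono le_imp_neg_le) auto
    then have "e * pmf (binomial_pmf n p') k
        \<le> exp (- (p' - p) * (real k - real n * p) / (p * (1 - p))) * pmf (binomial_pmf n p') k"
      by (rule mult_right_mono) simp
    also have "\<dots> \<le> pmf (binomial_pmf n p) k"
      using that p p'01 by (intro pmf_binomial_tilt) (auto simp: W_def)
    finally show ?thesis .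
  qed
  have "3 / 4 * e \<le> e * measure_pmf.prob (binomial_pmf n p') W"
    using W by (simp add: e_def mult.commute)
  also have "\<dots> \<le> measure_pmf.prob (binomial_pmf n p) W"
    using fin tilt by (simp add: measure_measure_pmf_finite sum_distrib_left sum_mono)
  also have "\<dots> \<le> measure_pmf.prob (binomial_pmf n p)
      {k. \<bar>real k - real n * p - a * sqrt n\<bar> \<le> sqrt n}"
    by (intro measure_pmf.finite_measure_mono) (auto simp: W_def)
  finally show ?thesis by (simp add: e_def)
qed

section \<open>Arrival counts and product probabilities\<close>

lemma map_pmf_eq_bernoulli: "map_pmf (\<lambda>x. x = j) q = bernoulli_pmf (pmf q j)"
proof (rule pmf_eqI)
  fix b
  have "pmf (map_pmf (\<lambda>x. x = j) q) True = pmf q j"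
    by (simp add: pmf_map pmf.rep_eq vimage_def)
  moreover have "pmf (map_pmf (\<lambda>x. x = j) q) False = 1 - pmf (map_pmf (\<lambda>x. x = j) q) True"
    by (rule pmf_False_conv_True)
  ultimately show "pmf (map_pmf (\<lambda>x. x = j) q) b = pmf (bernoulli_pmf (pmf q j)) b"
    by (cases b) (auto simp: pmf_le_1)
qed

lemma map_pmf_count_binomial:
  assumes "finite S"
  shows "map_pmf (\<lambda>A. card {t \<in> S. A t = j}) (Pi_pmf S d (\<lambda>_. q)) = binomial_pmf (card S) (pmf q j)"
proof -
  \<comment> \<open>Mapping each coordinate to the test for \<open>j\<close> turns the default
    \<open>d\<close> into \<open>d = j\<close>.\<close>
  have "binomial_pmf (card S) (pmf q j)
      = map_pmf (\<lambda>f. card {t \<in> S. f t}) (Pi_pmf S (d = j) (\<lambda>_. bernoulli_pmf (pmf q j)))"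
    using assms by (intro binomial_pmf_altdef') (auto simp: pmf_le_1)
  also have "\<dots> = map_pmf (\<lambda>A. card {t \<in> S. A t = j}) (Pi_pmf S d (\<lambda>_. q))"
    using assms by (subst map_pmf_eq_bernoulli[symmetric], subst Pi_pmf_map[where dflt = d])
      (simp_all add: pmf.map_comp o_def)
  finally show ?thesis ..
qed

lemma measure_pair_pmf_Times:
  "measure_pmf.prob (pair_pmf M N) (A \<times> B) = measure_pmf.prob M A * measure_pmf.prob N B"
proof -
  \<comment> \<open>The product rule applied below is for countable sets; intersecting with the
    supports reduces arbitrary events to that case.\<close>
  have "measure_pmf.prob (pair_pmf M N) (A \<times> B)
      = measure_pmf.prob (pair_pmf M N) ((A \<inter> set_pmf M) \<times> (B \<inter> set_pmf N))"
    by (intro measure_pmf.finite_measure_eq_AE) (auto simp: AE_measure_pmf_iff)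
  also have "\<dots> = measure_pmf.prob M (A \<inter> set_pmf M) * measure_pmf.prob N (B \<inter> set_pmf N)"
    by (intro measure_pmf_prob_product) auto
  finally show ?thesis by (simp add: measure_Int_set_pmf)
qed

subsection \<open>Averaging over the seed\<close>

lemma finite_customer_types [simp]: "finite (customer_types I)"
  by (simp add: customer_types_def)

lemma objective_cong:
  assumes "\<And>j. j \<in> customer_types I \<Longrightarrow> x j = y j"
  shows "objective I x = objective I y"
proof -
  have "shows_pmf I x = shows_pmf I y"
    unfolding shows_pmf_def using assms by (intro Pi_pmf_cong) auto
  then show ?thesis using assms by (simp add: objective_def)
qed

text \<open>Bridges the acceptance vectors of a policy, which are plain functions, and the
  extensional ones over which \<open>offline_opt\<close> maximizes.\<close>

lemma objective_restrict: "objective I (restrict x (customer_types I)) = objective I x"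
  by (rule objective_cong) simp

lemma objective_le_offline_opt:
  assumes "\<And>j. j \<in> customer_types I \<Longrightarrow> x j \<le> num_arrivals I A j"
  shows "objective I x \<le> offline_opt I A"
  unfolding offline_opt_def
proof (rule Max_ge)
  show "finite (objective I ` (\<Pi>\<^sub>E j\<in>customer_types I. {0..num_arrivals I A j}))"
    by (intro finite_imageI finite_PiE) auto
  show "objective I x \<in> objective I ` (\<Pi>\<^sub>E j\<in>customer_types I. {0..num_arrivals I A j})"
    using assms by (subst objective_restrict[symmetric], intro imageI) auto
qed

lemma num_arrivals_le_horizon: "num_arrivals I A j \<le> horizon I"
  unfolding num_arrivals_def
  by (rule order_trans[OF card_mono[of "{1..horizon I}"]]) auto

lemma accepted_le_num_arrivals: "accepted I D u A j \<le> num_arrivals I A j"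
  unfolding accepted_def num_arrivals_def by (rule card_mono) auto

lemma policy_objective_le_offline_opt: "policy_objective I D u A \<le> offline_opt I A"
  unfolding policy_objective_def by (intro objective_le_offline_opt accepted_le_num_arrivals)

text \<open>Only finitely many acceptance vectors are bounded by the horizon. The bound is uniform
  in arrivals and seed and supplies integrability later.\<close>

lemma loss_bounded: "\<exists>K. \<forall>A u. \<bar>offline_opt I A - policy_objective I D u A\<bar> \<le> K"
proof -
  define P where "P = (\<Pi>\<^sub>E j\<in>customer_types I. {0..horizon I})"
  define K where "K = Max ((\<lambda>x. \<bar>objective I x\<bar>) ` P)"
  have fin: "finite P" unfolding P_def by (intro finite_PiE) auto
  have K: "\<bar>objective I x\<bar> \<le> K" if "x \<in> P" for x
    unfolding K_def using fin that by (intro Max_ge) auto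
  have opt: "\<bar>offline_opt I A\<bar> \<le> K" for A
  proof -
    have "offline_opt I A \<in> objective I ` (\<Pi>\<^sub>E j\<in>customer_types I. {0..num_arrivals I A j})"
      unfolding offline_opt_def
      by (intro Max_in finite_imageI finite_PiE) (auto simp: PiE_eq_empty_iff)
    moreover have "(\<Pi>\<^sub>E j\<in>customer_types I. {0..num_arrivals I A j}) \<subseteq> P"
      unfolding P_def using num_arrivals_le_horizon by (intro PiE_mono) auto
    ultimately show ?thesis using K by auto
  qed
  have pol: "\<bar>policy_objective I D u A\<bar> \<le> K" for u A
    unfolding policy_objective_def objective_restrict[symmetric, of I "accepted I D u A"]
    using order_trans[OF accepted_le_num_arrivals num_arrivals_le_horizon]
    by (intro K) (auto simp: P_def)
  have "\<bar>offline_opt I A - policy_objective I D u A\<bar> \<le> 2 * K" for A u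
    using opt[of A] pol[of u A] by linarith
  then show ?thesis by blast
qed

text \<open>For fixed arrivals the objective depends on the seed only through the set of accepting
  periods, so it is a finite sum over the possible sets.\<close>

lemma policy_objective_measurable:
  assumes "\<And>t. t \<in> {1..horizon I} \<Longrightarrow> Measurable.pred R (\<lambda>u. D u t A)"
  shows "(\<lambda>u. policy_objective I D u A) \<in> borel_measurable R"
proof -
  note assms[measurable]
  define f where "f S = objective I (\<lambda>j. card {t \<in> S. A t = j})" for S :: "nat set"
  have "policy_objective I D u A
      = (\<Sum>S\<in>Pow {1..horizon I}. if \<forall>t\<in>{1..horizon I}. D u t A \<longleftrightarrow> t \<in> S then f S else 0)" for u
  proof -
    let ?S = "{t \<in> {1..horizon I}. D u t A}"
    have "(\<Sum>S\<in>Pow {1..horizon I}. if \<forall>t\<in>{1..horizon I}. D u t A \<longleftrightarrow> t \<in> S then f S else 0)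
        = (\<Sum>S\<in>Pow {1..horizon I}. if S = ?S then f S else 0)"
      by (intro sum.cong) auto
    also have "\<dots> = f ?S" by (subst sum.delta) auto
    also have "\<dots> = policy_objective I D u A"
      unfolding f_def policy_objective_def accepted_def
      by (intro arg_cong[where f = "objective I"] ext arg_cong[where f = card]) auto
    finally show ?thesis ..
  qed
  then show ?thesis by simp
qed

text \<open>With \<open>h \<le> horizon I\<close> every period that a decision may look at lies
  within the horizon.\<close>

lemma loss_cong:
  assumes pol: "informed_online_policy I h R D" and h: "h \<le> horizon I" and u: "u \<in> space R"
    and eq: "\<And>t. t \<in> {1..horizon I} \<Longrightarrow> A t = A' t"
  shows "offline_opt I A - policy_objective I D u A = offline_opt I A' - policy_objective I D u A'"
proof -
  have "D u t A = D u t A'" if "t \<in> {1..horizon I}" for t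
  proof -
    have "\<forall>s\<in>{1..max t h}. A s = A' s" using that h eq by auto
    then show ?thesis using pol that u unfolding informed_online_policy_def by blast
  qed
  then have "accepted I D u A = accepted I D u A'" "num_arrivals I A = num_arrivals I A'"
    unfolding accepted_def num_arrivals_def using eq
    by (auto intro!: ext arg_cong[where f = card])
  then show ?thesis by (simp add: offline_opt_def policy_objective_def)
qed

lemma loss_measurable:
  assumes pol: "informed_online_policy I h R D" and h: "h \<le> horizon I"
  shows "(\<lambda>(A, u). offline_opt I A - policy_objective I D u A)
    \<in> borel_measurable (measure_pmf p \<Otimes>\<^sub>M R)"
proof -
  \<comment> \<open>The function space is uncountable, so measurability in the product is not just measurability in
    each section; the loss factors through the countable type of lists.\<close>
  define enc where "enc A = map A [0..<Suc (horizon I)]" for A :: "nat \<Rightarrow> nat"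
  \<comment> \<open>The encoded list begins at period 0, so that list index and period
    agree.\<close>
  define dec where "dec xs t = xs ! t" for xs :: "nat list" and t
  define f where "f A u = offline_opt I A - policy_objective I D u A" for A u
  have f: "f A \<in> borel_measurable R" for A
    unfolding f_def using pol
    by (intro borel_measurable_diff policy_objective_measurable) (auto simp: informed_online_policy_def)
  have "(\<lambda>(xs, u). f (dec xs) u) \<in> borel_measurable (count_space UNIV \<Otimes>\<^sub>M R)"
    by (rule measurable_pair_measure_countable1) (auto simp: f)
  then have "(\<lambda>x. (\<lambda>(xs, u). f (dec xs) u) (enc (fst x), snd x))
      \<in> borel_measurable (measure_pmf p \<Otimes>\<^sub>M R)"
    by (rule measurable_compose[rotated])
      (intro measurable_Pair measurable_compose[OF measurable_fst, where g = enc] measurable_snd, simp)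
  then have "(\<lambda>(A, u). f (dec (enc A)) u) \<in> borel_measurable (measure_pmf p \<Otimes>\<^sub>M R)"
    by (simp add: case_prod_unfold)
  moreover have "f (dec (enc A)) u = f A u" if "u \<in> space R" for A u
    unfolding f_def using that
    by (intro loss_cong[OF pol h]) (auto simp: enc_def dec_def simp del: upt_Suc)
  ultimately show ?thesis
    unfolding f_def[symmetric]
    by (subst measurable_cong[where g = "\<lambda>(A, u). f (dec (enc A)) u"]) (auto simp: space_pair_measure)
qed

text \<open>By Fubini the expected loss is the average over the seed of the losses of deterministic
  policies, so a bound uniform in the seed suffices.\<close>

lemma expected_loss_ge:
  assumes pol: "informed_online_policy I h R D" and h: "h \<le> horizon I"
    and ge: "\<And>u. u \<in> space R \<Longrightarrow> c \<le> measure_pmf.expectation (arrivals_pmf I)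
      (\<lambda>A. offline_opt I A - policy_objective I D u A)"
  shows "c \<le> expected_loss I R D"
proof -
  interpret R: prob_space R using pol by (simp add: informed_online_policy_def)
  interpret P: pair_prob_space "measure_pmf (arrivals_pmf I)" R ..
  define f where "f A u = offline_opt I A - policy_objective I D u A" for A u
  obtain K where K: "\<And>A u. \<bar>f A u\<bar> \<le> K" unfolding f_def using loss_bounded by metis
  have int: "integrable (measure_pmf (arrivals_pmf I) \<Otimes>\<^sub>M R) (\<lambda>(A, u). f A u)"
    unfolding f_def using K
    by (intro P.P.integrable_const_bound[where B = K] loss_measurable[OF pol h]) (auto simp: f_def)
  have "c = (\<integral>u. c \<partial>R)" by (simp add: R.prob_space)
  also have "\<dots> \<le> (\<integral>u. measure_pmf.expectation (arrivals_pmf I) (\<lambda>A. f A u) \<partial>R)"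
    using ge unfolding f_def[symmetric]
    by (intro integral_mono) (auto intro: P.integrable_snd int)
  also have "\<dots> = expected_loss I R D"
    unfolding expected_loss_def f_def[symmetric] by (rule P.integral_snd[OF int])
  finally show ?thesis .
qed

subsection \<open>Objective bounds\<close>

lemma finite_set_shows_pmf:
  assumes "\<And>j. j \<in> customer_types I \<Longrightarrow> show_prob I j \<in> {0..1}"
  shows "finite (set_pmf (shows_pmf I x))"
  unfolding shows_pmf_def using assms
  by (subst set_Pi_pmf) (auto intro!: finite_PiE_dflt finite_set_pmf_binomial_pmf)

lemma expectation_shows_pmf_component:
  fixes f :: "nat \<Rightarrow> real"
  assumes "j \<in> customer_types I"
  shows "measure_pmf.expectation (shows_pmf I x) (\<lambda>X. f (X j))
    = measure_pmf.expectation (binomial_pmf (x j) (show_prob I j)) f"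
proof -
  have "binomial_pmf (x j) (show_prob I j) = map_pmf (\<lambda>X. X j) (shows_pmf I x)"
    unfolding shows_pmf_def using assms by (subst Pi_pmf_component) auto
  then show ?thesis by (simp only: integral_map_pmf)
qed

lemma shows_le:
  assumes "\<And>j. j \<in> customer_types I \<Longrightarrow> show_prob I j \<in> {0..1}"
    and "X \<in> set_pmf (shows_pmf I x)" "j \<in> customer_types I"
  shows "X j \<le> x j"
proof -
  have "X j \<in> set_pmf (binomial_pmf (x j) (show_prob I j))"
    using assms(2,3) unfolding shows_pmf_def by (subst (asm) set_Pi_pmf) (auto simp: PiE_dflt_def)
  then show ?thesis
    using assms(1)[OF assms(3)] by (subst (asm) set_pmf_binomial_eq) (auto split: if_splits)
qed

text \<open>Overflow is relaxed to a price \<open>\<theta>\<close> per customer showing up beyond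
  capacity, since \<open>\<theta> * y \<le> max 0 y\<close> for such \<open>\<theta>\<close>. Prices
  1/2 and 0 are used below.\<close>

lemma objective_le_linear:
  assumes p: "\<And>j. j \<in> customer_types I \<Longrightarrow> show_prob I j \<in> {0..1}" and \<theta>: "0 \<le> \<theta>" "\<theta> \<le> 1"
  shows "objective I x \<le> (\<Sum>j\<in>customer_types I. fare I j * real (x j))
    - \<theta> * ((\<Sum>j\<in>customer_types I. show_prob I j * real (x j)) - capacity I)"
proof -
  have int: "integrable (measure_pmf (shows_pmf I x)) f" for f :: "_ \<Rightarrow> real"
    by (intro integrable_measure_pmf_finite finite_set_shows_pmf p)
  have "measure_pmf.expectation (shows_pmf I x) (\<lambda>X. \<Sum>j\<in>customer_types I. real (X j))
      = (\<Sum>j\<in>customer_types I. show_prob I j * real (x j))"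
    unfolding Bochner_Integration.integral_sum[OF int]
    by (intro sum.cong refl, subst expectation_shows_pmf_component, assumption,
        subst expectation_binomial_pmf[OF p]) simp_all
  then have "\<theta> * ((\<Sum>j\<in>customer_types I. show_prob I j * real (x j)) - capacity I)
      = measure_pmf.expectation (shows_pmf I x)
          (\<lambda>X. \<theta> * ((\<Sum>j\<in>customer_types I. real (X j)) - capacity I))"
    by (simp add: Bochner_Integration.integral_diff[OF int int])
  also have "\<dots> \<le> measure_pmf.expectation (shows_pmf I x)
      (\<lambda>X. max 0 ((\<Sum>j\<in>customer_types I. real (X j)) - capacity I))"
  proof (intro integral_mono int)
    fix X
    have "\<theta> * y \<le> max 0 y" for y :: real
      using mult_left_mono[of 0 y "1 - \<theta>"] mult_nonneg_nonpos[of \<theta> y] \<theta>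
      by (cases "0 \<le> y") (auto simp: algebra_simps)
    then show "\<theta> * ((\<Sum>j\<in>customer_types I. real (X j)) - capacity I)
        \<le> max 0 ((\<Sum>j\<in>customer_types I. real (X j)) - capacity I)" .
  qed
  finally show ?thesis by (simp add: objective_def)
qed

lemma objective_no_overflow:
  assumes p: "\<And>j. j \<in> customer_types I \<Longrightarrow> show_prob I j \<in> {0..1}"
    and "(\<Sum>j\<in>customer_types I. real (x j)) \<le> capacity I"
  shows "objective I x = (\<Sum>j\<in>customer_types I. fare I j * real (x j))"
proof -
  have "measure_pmf.expectation (shows_pmf I x)
      (\<lambda>X. max 0 ((\<Sum>j\<in>customer_types I. real (X j)) - capacity I))
    = measure_pmf.expectation (shows_pmf I x) (\<lambda>_. 0)"
  proof (intro integral_cong_AE)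
    have "(\<Sum>j\<in>customer_types I. real (X j)) \<le> capacity I" if "X \<in> set_pmf (shows_pmf I x)" for X
      using shows_le[OF p that] by (intro order_trans[OF sum_mono assms(2)]) auto
    then show "AE X in measure_pmf (shows_pmf I x).
        max 0 ((\<Sum>j\<in>customer_types I. real (X j)) - capacity I) = 0"
      by (auto simp: AE_measure_pmf_iff)
  qed auto
  then show ?thesis by (simp add: objective_def)
qed

text \<open>Serves to show that slack of the same order as the mean leaves only a constant expected
  overflow.\<close>

lemma binomial_overflow_le:
  assumes p: "p \<in> {0..1}" and "a > 0"
  shows "measure_pmf.expectation (binomial_pmf n p) (\<lambda>k. max 0 (real k - real n * p - a))
    \<le> real n * p / (4 * a)"
proof -
  \<comment> \<open>AM-GM: \<open>y * (4 * a) - 4 * a\<^sup>2 \<le> y\<^sup>2\<close>\<close>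
  have "max 0 (y - a) \<le> y\<^sup>2 / (4 * a)" for y :: real
    using sum_squares_ge_zero[of "y - 2 * a" 0] \<open>a > 0\<close>
    by (auto simp: field_simps power2_eq_square max_def)
  then have "measure_pmf.expectation (binomial_pmf n p) (\<lambda>k. max 0 (real k - real n * p - a))
      \<le> measure_pmf.expectation (binomial_pmf n p) (\<lambda>k. (real k - real n * p)\<^sup>2 / (4 * a))"
    using p by (intro integral_mono) auto
  also have "\<dots> = real n * p * (1 - p) / (4 * a)"
    using p by (simp add: variance_binomial_pmf)
  also have "\<dots> \<le> real n * p * 1 / (4 * a)"
    using p \<open>a > 0\<close> by (intro divide_right_mono mult_left_mono) auto
  finally show ?thesis by simp
qed

section \<open>Pointwise loss in the two scenarios\<close>

lemma hard_instance_simps [simp]: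
  "customer_types (hard_instance T) = {1, 2, 3}"
  "horizon (hard_instance T) = T"
  "capacity (hard_instance T) = real T / 6"
  "fare (hard_instance T) (Suc 0) = 1 / 2"
  "fare (hard_instance T) 2 = 1 / sqrt (real T)"
  "fare (hard_instance T) 3 = 0"
  "show_prob (hard_instance T) (Suc 0) = 1"
  "show_prob (hard_instance T) 2 = 3 / sqrt (real T)"
  "show_prob (hard_instance T) 3 = 1"
  by (auto simp: customer_types_def hard_instance_def)

lemma show_prob_hard_instance:
  assumes "T \<ge> 9" "j \<in> customer_types (hard_instance T)"
  shows "show_prob (hard_instance T) j \<in> {0..1}"
proof -
  have "3 \<le> sqrt (real T)" using assms by (intro real_le_rsqrt) auto
  then show ?thesis using assms(2) by (auto simp: divide_le_eq)
qed

text \<open>Filling the capacity with type 1 alone earns \<open>T / 12\<close>. At price 1/2 per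
  customer showing up, type 1 breaks even, while a type 2 customer earns \<open>1 / sqrt T\<close>
  and costs \<open>3 / (2 * sqrt T)\<close>.\<close>

lemma loss_many_type1:
  assumes T: "T \<ge> 9" "6 dvd T" and N1: "T div 6 \<le> num_arrivals (hard_instance T) A 1"
  shows "real (x 2) / (2 * sqrt T) \<le> offline_opt (hard_instance T) A - objective (hard_instance T) x"
proof -
  let ?I = "hard_instance T"
  define z :: "nat \<Rightarrow> nat" where "z = (\<lambda>_. 0)(1 := T div 6)"
  have B: "real (T div 6) = real T / 6" using T by (simp add: real_of_nat_div)
  have "real T / 12 = objective ?I z"
    by (subst objective_no_overflow[OF show_prob_hard_instance[OF T(1)]]) (auto simp: z_def B)
  also have "\<dots> \<le> offline_opt ?I A"
    using N1 by (intro objective_le_offline_opt) (auto simp: z_def)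
  finally have opt: "real T / 12 \<le> offline_opt ?I A" .
  have "objective ?I x \<le> (\<Sum>j\<in>customer_types ?I. fare ?I j * real (x j))
    - 1/2 * ((\<Sum>j\<in>customer_types ?I. show_prob ?I j * real (x j)) - capacity ?I)"
    by (intro objective_le_linear show_prob_hard_instance[OF T(1)]) auto
  also have "\<dots> = real T / 12 - real (x 2) / (2 * sqrt T) - real (x 3) / 2"
    by (simp add: algebra_simps)
  finally show ?thesis using opt by linarith
qed

text \<open>The comparison \<open>z\<close> accepts all of types 1 and 2. Of the gap
  \<open>4 * sqrt T\<close>, the mean show-up of type 2 takes at most \<open>3 * sqrt T\<close>; the
  remaining \<open>sqrt T\<close> keeps the expected overflow below or at 3/4. The objective of
  \<open>x\<close> is bounded by its fares, at price 0.\<close>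

lemma loss_few_type1:
  assumes T: "T \<ge> 9"
    and N1: "real (num_arrivals (hard_instance T) A 1) + 4 * sqrt T \<le> real T / 6"
    and x1: "x 1 \<le> num_arrivals (hard_instance T) A 1"
  shows "(real (num_arrivals (hard_instance T) A 2) - real (x 2)) / sqrt T - 3 / 4
    \<le> offline_opt (hard_instance T) A - objective (hard_instance T) x"
proof -
  let ?I = "hard_instance T"
  let ?N = "num_arrivals ?I A"
  define s where "s = sqrt T"
  define z :: "nat \<Rightarrow> nat" where "z = (\<lambda>_. 0)(1 := ?N 1, 2 := ?N 2)"
  have s: "s > 0" "s * s = T" using T by (auto simp: s_def)
  have p: "\<And>j. j \<in> customer_types ?I \<Longrightarrow> show_prob ?I j \<in> {0..1}"
    by (rule show_prob_hard_instance[OF T])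
  have p2: "3 / s \<in> {0..1}" using p[of 2] by (simp add: s_def)
  have "real (?N 2) \<le> T" using num_arrivals_le_horizon[of ?I A 2] by simp
  then have "real (?N 2) * (3 / s) \<le> (s * s) * (3 / s)"
    using s by (intro mult_right_mono) auto
  then have mean: "real (?N 2) * (3 / s) \<le> 3 * s" using s(1) by simp
  have int: "integrable (measure_pmf (shows_pmf ?I z)) f" for f :: "_ \<Rightarrow> real"
    by (intro integrable_measure_pmf_finite finite_set_shows_pmf p)
  have "measure_pmf.expectation (shows_pmf ?I z)
        (\<lambda>X. max 0 ((\<Sum>j\<in>customer_types ?I. real (X j)) - capacity ?I))
      \<le> measure_pmf.expectation (shows_pmf ?I z)
        (\<lambda>X. max 0 (real (X 2) - real (?N 2) * (3 / s) - s))"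
  proof (intro integral_mono_AE int)
    have "max 0 ((\<Sum>j\<in>customer_types ?I. real (X j)) - capacity ?I)
        \<le> max 0 (real (X 2) - real (?N 2) * (3 / s) - s)" if "X \<in> set_pmf (shows_pmf ?I z)" for X
    proof -
      have "X 1 \<le> ?N 1" "X 3 \<le> 0"
        using shows_le[OF p that, of 1] shows_le[OF p that, of 3] by (auto simp: z_def)
      then have "real (X 1) + (real (X 2) + real (X 3)) - real T / 6
          \<le> real (X 2) - real (?N 2) * (3 / s) - s"
        using mean N1 unfolding s_def[symmetric] by linarith
      then show ?thesis by (simp del: times_divide_eq_right)
    qed
    then show "AE X in measure_pmf (shows_pmf ?I z).
        max 0 ((\<Sum>j\<in>customer_types ?I. real (X j)) - capacity ?I)
        \<le> max 0 (real (X 2) - real (?N 2) * (3 / s) - s)"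
      by (auto simp: AE_measure_pmf_iff)
  qed
  also have "\<dots> = measure_pmf.expectation (binomial_pmf (?N 2) (3 / s))
        (\<lambda>k. max 0 (real k - real (?N 2) * (3 / s) - s))"
    by (subst expectation_shows_pmf_component) (auto simp: z_def s_def)
  also have "\<dots> \<le> real (?N 2) * (3 / s) / (4 * s)"
    by (rule binomial_overflow_le) (use p2 s in auto)
  also have "\<dots> \<le> 3 * s / (4 * s)"
    using mean s by (intro divide_right_mono) auto
  also have "\<dots> = 3 / 4" using s by simp
  finally have "real (?N 1) / 2 + real (?N 2) / s - 3 / 4 \<le> objective ?I z"
    unfolding objective_def by (simp add: z_def s_def)
  also have "\<dots> \<le> offline_opt ?I A"
    by (intro objective_le_offline_opt) (auto simp: z_def)
  finally have opt: "real (?N 1) / 2 + real (?N 2) / s - 3 / 4 \<le> offline_opt ?I A" .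
  have "objective ?I x \<le> (\<Sum>j\<in>customer_types ?I. fare ?I j * real (x j))
    - 0 * ((\<Sum>j\<in>customer_types ?I. show_prob ?I j * real (x j)) - capacity ?I)"
    by (intro objective_le_linear p) auto
  also have "\<dots> = real (x 1) / 2 + real (x 2) / s" by (simp add: s_def)
  also have "\<dots> \<le> real (?N 1) / 2 + real (x 2) / s" using x1 by simp
  finally show ?thesis using opt by (simp add: s_def diff_divide_distrib)
qed

subsection \<open>Loss on the hard instance\<close>

lemma prob_count_Pi_pmf:
  assumes "finite S"
  shows "measure_pmf.prob (Pi_pmf S d (\<lambda>_. q)) {A. card {t \<in> S. A t = j} \<in> X}
    = measure_pmf.prob (binomial_pmf (card S) (pmf q j)) X"
  using assms by (simp add: map_pmf_count_binomial[of S j d q, symmetric] vimage_def)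

text \<open>The factor 1/96 is a loss of \<open>sqrt T / 48\<close> times the probability 1/2 of a
  typical first half; the rest is the bound of \<open>binomial_pmf_window\<close> at
  \<open>p = 1 / 6\<close>, \<open>a = - 8\<close>.\<close>

lemma expected_loss_fixed_seed_ge:
  assumes T: "T \<ge> 10000" "6 dvd T"
    and pol: "informed_online_policy (hard_instance T) (T div 2) R D" and u: "u \<in> space R"
  shows "sqrt T / 96 * (3 / 4 * exp (- 8 * 9 / (1 / 6 * (1 - 1 / 6))))
    \<le> measure_pmf.expectation (arrivals_pmf (hard_instance T))
      (\<lambda>A. offline_opt (hard_instance T) A - policy_objective (hard_instance T) D u A)"
proof -
  define I where "I = hard_instance T"
  define n where "n = T div 2"
  define S1 where "S1 = {1..n}"
  define S2 where "S2 = {Suc n..T}"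
  define cnt where "cnt S A j = card {t \<in> S. A t = j}" for S and A :: "nat \<Rightarrow> nat" and j
  define PF where "PF = Pi_pmf S1 0 (\<lambda>_. type_pmf I)"
  define PG where "PG = Pi_pmf S2 0 (\<lambda>_. type_pmf I)"
  define merge where "merge F G x = (if x \<in> S1 then F x else G x)" for F G :: "nat \<Rightarrow> nat" and x
  define loss where "loss A = offline_opt I A - policy_objective I D u A" for A
  define c0 :: real where "c0 = 3 / 4 * exp (- 8 * 9 / (1 / 6 * (1 - 1 / 6)))"
  define s where "s = sqrt T"
  define r where "r = sqrt n"
  obtain k where k: "T = 6 * k" using T by auto
  have Tn: "T = 2 * n" using k by (simp add: n_def)
  \<comment> \<open>The size of \<open>T\<close> is used to keep the tilted parameter
    \<open>1 / 6 - 8 / r\<close> positive and to absorb the constant 3/4 into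
    \<open>s / 48\<close>.\<close>
  have s: "s \<ge> 100" "s * s = T" using T by (auto simp: s_def real_le_rsqrt)
  have r: "r \<ge> 70" "r * r = n" using T Tn by (auto simp: r_def intro!: real_le_rsqrt)
  \<comment> \<open>The exact ratio is \<open>sqrt 2\<close>; with 3/2 a shortfall of
    \<open>6 * r\<close> covers the required \<open>4 * s\<close>.\<close>
  have sr: "s \<le> 3 / 2 * r"
    unfolding s_def using r Tn by (intro real_le_lsqrt) (auto simp: power2_eq_square)
  have fin: "finite S1" "finite S2" and card: "card S1 = n" "card S2 = n"
    using Tn by (auto simp: S1_def S2_def)
  have split: "{1..T} = S1 \<union> S2" "S1 \<inter> S2 = {}" using Tn by (auto simp: S1_def S2_def)
  have arr: "arrivals_pmf I = map_pmf (\<lambda>(F, G). merge F G) (pair_pmf PF PG)"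
    unfolding arrivals_pmf_def I_def hard_instance_simps split(1) PF_def PG_def merge_def
    by (intro Pi_pmf_union fin split(2))
  have q: "pmf (type_pmf I) (Suc 0) = 1 / 6" "pmf (type_pmf I) 2 = 1 / 3"
    using pmf_type_pmf_hard_instance by (simp_all add: I_def)
  have num: "num_arrivals I (merge F G) j = cnt S1 F j + cnt S2 G j" for F G j
  proof -
    have "{t \<in> {1..T}. merge F G t = j} = {t \<in> S1. F t = j} \<union> {t \<in> S2. G t = j}"
      unfolding split(1) using split(2) by (auto simp: merge_def)
    then show ?thesis
      unfolding num_arrivals_def cnt_def I_def hard_instance_simps
      using fin split(2) by (simp add: card_Un_disjoint disjoint_iff)
  qed
  \<comment> \<open>Evaluating \<open>D\<close> at \<open>F\<close> alone is legitimate: in the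
    first half decisions see exactly the first \<open>n\<close> arrivals, whatever \<open>G\<close>
    is.\<close>
  define a2 where "a2 F = card {t \<in> S1. F t = 2 \<and> D u t F}" for F
  have acc: "a2 F \<le> accepted I D u (merge F G) 2"
    "accepted I D u (merge F G) 2 \<le> a2 F + cnt S2 G 2" for F G
  proof -
    have D: "D u t (merge F G) = D u t F" if "t \<in> S1" for t
    proof -
      have "\<forall>x\<in>{1..max t (T div 2)}. merge F G x = F x"
        using that by (auto simp: merge_def S1_def n_def)
      moreover have "t \<in> {1..horizon I}" using that Tn by (auto simp: I_def S1_def)
      ultimately show ?thesis
        using pol u unfolding informed_online_policy_def I_def by blast
    qed
    have "{t \<in> {1..T}. merge F G t = 2 \<and> D u t (merge F G)}
        = {t \<in> S1. F t = 2 \<and> D u t F} \<union> {t \<in> S2. G t = 2 \<and> D u t (merge F G)}"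
      unfolding split(1) using split(2) D by (auto simp: merge_def)
    then have "accepted I D u (merge F G) 2
        = a2 F + card {t \<in> S2. G t = 2 \<and> D u t (merge F G)}"
      unfolding accepted_def I_def hard_instance_simps a2_def
      using fin split(2) by (simp add: card_Un_disjoint disjoint_iff)
    moreover have "card {t \<in> S2. G t = 2 \<and> D u t (merge F G)} \<le> cnt S2 G 2"
      unfolding cnt_def using fin by (intro card_mono) auto
    ultimately show "a2 F \<le> accepted I D u (merge F G) 2"
      "accepted I D u (merge F G) 2 \<le> a2 F + cnt S2 G 2" by auto
  qed
  \<comment> \<open>On \<open>E\<close> at least \<open>n / 6\<close> customers of type 2 arrive in
    the first half; \<open>P\<close> below asks whether half of that number is accepted.\<close>
  define E where "E = {F. \<bar>real (cnt S1 F 1) - real n * (1 / 6)\<bar> < r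
    \<and> \<bar>real (cnt S1 F 2) - real n * (1 / 3)\<bar> < real n / 6}"
  define P where "P = {F. real n / 12 \<le> real (a2 F)}"
  \<comment> \<open>With first-half deviation below \<open>r\<close> and window radius
    \<open>r\<close>, the choice \<open>a = 2\<close> gives total type 1 deviation at least 0, and
    \<open>a = - 8\<close> gives at most \<open>- 6 * r\<close>.\<close>
  define W where "W a = {G. \<bar>real (cnt S2 G 1) - real n * (1 / 6) - a * r\<bar> \<le> r}" for a
  have prob_E: "1 / 2 \<le> measure_pmf.prob PF E"
  proof -
    define E1 where "E1 = {F. \<bar>real (cnt S1 F 1) - real n * (1 / 6)\<bar> \<ge> r}"
    define E2 where "E2 = {F. \<bar>real (cnt S1 F 2) - real n * (1 / 3)\<bar> \<ge> real n / 6}"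
    have "measure_pmf.prob PF E1
        = measure_pmf.prob (binomial_pmf n (1 / 6)) {k. \<bar>real k - real n * (1 / 6)\<bar> \<ge> r}"
      using prob_count_Pi_pmf[OF fin(1), of 0 "type_pmf I" 1 "{k. \<bar>real k - real n * (1 / 6)\<bar> \<ge> r}"]
      by (simp add: E1_def PF_def cnt_def q card)
    also have "\<dots> \<le> real n * (1 / 6) * (1 - 1 / 6) / r\<^sup>2"
      using r by (intro binomial_pmf_deviation) auto
    also have "\<dots> = 5 / 36" using r T Tn by (simp add: power2_eq_square)
    finally have 1: "measure_pmf.prob PF E1 \<le> 5 / 36" .
    have "measure_pmf.prob PF E2
        = measure_pmf.prob (binomial_pmf n (1 / 3)) {k. \<bar>real k - real n * (1 / 3)\<bar> \<ge> real n / 6}"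
      using prob_count_Pi_pmf[OF fin(1), of 0 "type_pmf I" 2
        "{k. \<bar>real k - real n * (1 / 3)\<bar> \<ge> real n / 6}"]
      by (simp add: E2_def PF_def cnt_def q card)
    also have "\<dots> \<le> real n * (1 / 3) * (1 - 1 / 3) / (real n / 6)\<^sup>2"
      using T Tn by (intro binomial_pmf_deviation) auto
    also have "\<dots> = 8 / real n" using T Tn by (simp add: power2_eq_square field_simps)
    also have "\<dots> \<le> 1 / 4" using T Tn by (simp add: field_simps)
    finally have 2: "measure_pmf.prob PF E2 \<le> 1 / 4" .
    \<comment> \<open>The exceptional events have total probability at most 5/36 + 1/4, which is
      less than 1/2.\<close>
    have "1 - measure_pmf.prob PF (E1 \<union> E2) = measure_pmf.prob PF (- (E1 \<union> E2))"
      using measure_pmf.prob_compl[of "E1 \<union> E2" PF] by (simp add: Compl_eq_Diff_UNIV)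
    also have "- (E1 \<union> E2) = E" by (auto simp: E_def E1_def E2_def)
    finally show ?thesis
      using measure_Un_le[of E1 "measure_pmf PF" E2] 1 2 by simp
  qed
  \<comment> \<open>\<open>c0\<close> is the bound for \<open>a = - 8\<close>; the one for
    \<open>a = 2\<close> is larger.\<close>
  have prob_W: "c0 \<le> measure_pmf.prob PG (W a)" if a: "a = 2 \<or> a = - 8" for a
  proof -
    have "c0 \<le> 3 / 4 * exp (- \<bar>a\<bar> * (\<bar>a\<bar> + 1) / (1 / 6 * (1 - 1 / 6)))"
      using a by (auto simp: c0_def)
    also have "\<dots> \<le> measure_pmf.prob (binomial_pmf n (1 / 6))
        {k. \<bar>real k - real n * (1 / 6) - a * sqrt n\<bar> \<le> sqrt n}"
      using a r T Tn by (intro binomial_pmf_window) (auto simp: r_def[symmetric] field_simps)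
    also have "\<dots> = measure_pmf.prob PG (W a)"
      using prob_count_Pi_pmf[OF fin(2), of 0 "type_pmf I" 1
        "{k. \<bar>real k - real n * (1 / 6) - a * r\<bar> \<le> r}"]
      by (simp add: W_def PG_def cnt_def q card r_def)
    finally show ?thesis .
  qed
  have nonneg: "0 \<le> loss A" for A
    using policy_objective_le_offline_opt[of I D u A] by (simp add: loss_def)
  have hi: "s / 48 \<le> loss (merge F G)" if "F \<in> E \<inter> P" "G \<in> W 2" for F G
  proof -
    have "real n / 3 \<le> real (cnt S1 F 1) + real (cnt S2 G 1)"
      using that by (auto simp: E_def W_def)
    then have "T div 6 \<le> num_arrivals I (merge F G) 1"
      using Tn k unfolding num by simp
    then have "real (accepted I D u (merge F G) 2) / (2 * s) \<le> loss (merge F G)"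
      unfolding loss_def policy_objective_def I_def s_def using T by (intro loss_many_type1) auto
    \<comment> \<open>\<open>n / 12\<close> equals \<open>s * s / 24\<close>, because
      \<open>T = 2 * n\<close>.\<close>
    moreover have "s * s / 24 \<le> real (accepted I D u (merge F G) 2)"
      using that(1) acc(1)[of F G] Tn s(2) by (auto simp: P_def)
    then have "s * s / 24 / (2 * s) \<le> real (accepted I D u (merge F G) 2) / (2 * s)"
      using s(1) by (intro divide_right_mono) auto
    moreover have "s * s / 24 / (2 * s) = s / 48" using s(1) by (simp add: field_simps)
    ultimately show ?thesis by linarith
  qed
  have lo: "s / 48 \<le> loss (merge F G)" if "F \<in> E - P" "G \<in> W (- 8)" for F G
  proof -
    have "real (cnt S1 F 1) + real (cnt S2 G 1) \<le> real n / 3 - 6 * r"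
      using that by (auto simp: E_def W_def)
    then have "real (num_arrivals I (merge F G) 1) + 4 * s \<le> real T / 6"
      using Tn sr unfolding num by simp
    then have "(real (num_arrivals I (merge F G) 2) - real (accepted I D u (merge F G) 2)) / s - 3 / 4
        \<le> loss (merge F G)"
      unfolding loss_def policy_objective_def I_def s_def
      using T accepted_le_num_arrivals by (intro loss_few_type1) auto
    \<comment> \<open>Second-half arrivals of type 2 cancel: even accepting all of them leaves the
      first-half rejections, at least \<open>n / 6 - n / 12\<close>.\<close>
    moreover have "s * s / 24 \<le> real (num_arrivals I (merge F G) 2) - real (accepted I D u (merge F G) 2)"
    proof -
      have "real (accepted I D u (merge F G) 2) \<le> real (a2 F) + real (cnt S2 G 2)"
        using acc(2)[of F G] by linarith
      moreover have "real n / 6 \<le> real (cnt S1 F 2)" "real (a2 F) \<le> real n / 12"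
        using that(1) unfolding E_def P_def Diff_iff mem_Collect_eq by linarith+
      moreover have "s * s / 24 = real n / 12" using Tn s(2) by simp
      ultimately show ?thesis unfolding num of_nat_add by linarith
    qed
    then have "s * s / 24 / s \<le> (real (num_arrivals I (merge F G) 2)
        - real (accepted I D u (merge F G) 2)) / s"
      using s(1) by (intro divide_right_mono) auto
    moreover have "s * s / 24 / s = s / 24" using s(1) by (simp add: field_simps)
    ultimately show ?thesis using s(1) by linarith
  qed
  obtain K where K: "\<And>A. \<bar>loss A\<bar> \<le> K" using loss_bounded[of I D] by (auto simp: loss_def)
  have "s / 96 * c0 \<le> s / 48 * c0 * measure_pmf.prob PF E"
    using mult_left_mono[OF prob_E, of "s / 48 * c0"] s(1) by (simp add: c0_def)
  \<comment> \<open>Whether \<open>P\<close> holds is settled by the first half; each part of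
    \<open>E\<close> is then paired with the second-half window that is bad for it.\<close>
  also have "measure_pmf.prob PF E = measure_pmf.prob PF (E \<inter> P) + measure_pmf.prob PF (E - P)"
    by (subst measure_pmf.finite_measure_Union[symmetric])
      (auto intro!: arg_cong[where f = "measure _"])
  also have "s / 48 * c0 * \<dots> = s / 48 * (measure_pmf.prob PF (E \<inter> P) * c0
      + measure_pmf.prob PF (E - P) * c0)"
    by (simp add: algebra_simps)
  also have "\<dots> \<le> s / 48 * (measure_pmf.prob PF (E \<inter> P) * measure_pmf.prob PG (W 2)
      + measure_pmf.prob PF (E - P) * measure_pmf.prob PG (W (- 8)))"
    using s(1) by (intro mult_left_mono add_mono prob_W) auto
  also have "\<dots> = measure_pmf.expectation (pair_pmf PF PG)
      (\<lambda>x. s / 48 * (indicator ((E \<inter> P) \<times> W 2) x + indicator ((E - P) \<times> W (- 8)) x))"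
    unfolding measure_pair_pmf_Times[symmetric]
    by (simp add: measure_pmf.emeasure_finite less_top[symmetric])
  also have "\<dots> \<le> measure_pmf.expectation (pair_pmf PF PG) (\<lambda>(F, G). loss (merge F G))"
  proof (intro integral_mono)
    show "integrable (measure_pmf (pair_pmf PF PG)) (\<lambda>(F, G). loss (merge F G))"
      using K by (intro measure_pmf.integrable_const_bound[where B = K]) auto
    \<comment> \<open>The two rectangles are disjoint, so at most one indicator is 1; outside both,
      the loss is nonnegative.\<close>
    show "s / 48 * (indicator ((E \<inter> P) \<times> W 2) x + indicator ((E - P) \<times> W (- 8)) x)
        \<le> (case x of (F, G) \<Rightarrow> loss (merge F G))" for x
      using hi lo nonneg by (cases x) (auto simp: indicator_def)
  qed (auto simp: measure_pmf.emeasure_finite less_top[symmetric])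
  also have "\<dots> = measure_pmf.expectation (arrivals_pmf I) loss"
    by (simp add: arr case_prod_unfold)
  finally show ?thesis by (simp add: s_def c0_def I_def loss_def[abs_def])
qed

theorem mainTheorem6:
  shows "\<exists>(c::real) (T0::nat). c > 0 \<and>
    (\<forall>(T::nat) (R :: real measure) (D :: policy).
       T \<ge> 9 \<longrightarrow> 6 dvd T \<longrightarrow> T \<ge> T0 \<longrightarrow>
       informed_online_policy (hard_instance T) (T div 2) R D \<longrightarrow>
       expected_loss (hard_instance T) R D \<ge> c * sqrt (real T))"
proof (intro exI conjI allI impI)
  \<comment> \<open>The witnesses are the constant from \<open>expected_loss_fixed_seed_ge\<close>
    and the threshold 10000.\<close>
  show "(0::real) < 1 / 96 * (3 / 4 * exp (- 8 * 9 / (1 / 6 * (1 - 1 / 6))))" by simp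
  fix T :: nat and R :: "real measure" and D :: policy
  assume T: "6 dvd T" "T \<ge> 10000"
    and pol: "informed_online_policy (hard_instance T) (T div 2) R D"
  show "expected_loss (hard_instance T) R D
      \<ge> 1 / 96 * (3 / 4 * exp (- 8 * 9 / (1 / 6 * (1 - 1 / 6)))) * sqrt (real T)"
    using expected_loss_fixed_seed_ge[OF T(2,1) pol]
    by (intro expected_loss_ge[OF pol]) (simp_all add: mult_ac)
qed

end
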